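(* Let $d\ge 1$ and let $T:\mathbb{R}^{d}\times\mathbb{R}^{d}\to\mathbb{R}^{d}$ be a smooth ($C^\infty$) two-agent allocation rule that is implementable in dominant strategy. Then there exists a function $V_1:\mathbb{R}^d\times\mathbb{R}^d\to\mathbb{R}$ such that $T(x,y)=\nabla_x V_1(x,y)$ for all $(x,y)\in\mathbb{R}^d\times\mathbb{R}^d$, and such that for all $(x,y)$, $V_1$ satisfies Fritz John's equation $$\frac{\partial^{2}V_1(x,y)}{\partial x_i\,\partial y_j}=\frac{\partial^{2}V_1(x,y)}{\partial x_j\,\partial y_i},\qquad 1\le i,j\le d,$$ and the resulting symmetric matrix $\left(\frac{\partial^{2}V_1(x,y)}{\partial x_i\partial y_j}\right)_{1\le i,j\le d}$ is positive semidefinite. Similarly, there exists a function $V_2:\mathbb{R}^d\times\mathbb{R}^d\to\mathbb{R}$ such that $T(x,y)=\nabla_y V_2(x,y)$ for all $(x,y)$, and such that for all $(x,y)$, $$\frac{\partial^{2}V_2(x,y)}{\partial x_i\,\partial y_j}=\frac{\partial^{2}V_2(x,y)}{\partial x_j\,\partial y_i},\qquad 1\le i,j\le d,$$ and the symmetric matrix $\left(\frac{\partial^{2}V_2(x,y)}{\partial x_i\partial y_j}\right)_{1\le i,j\le d}$ is positive semidefinite.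
   Context: There are two agents; the type of agent 1 is $x\in\mathbb{R}^d$ and the type of agent 2 is $y\in\mathbb{R}^d$. Outcomes are elements $z\in\mathbb{R}^d$. An allocation rule is a map $T:\mathbb{R}^d\times\mathbb{R}^d\to\mathbb{R}^d$, where $z=T(x,y)$ is the outcome selected when agent 1 announces $x$ and agent 2 announces $y$. Payment rules are functions $\pi_1,\pi_2:\mathbb{R}^d\times\mathbb{R}^d\to\mathbb{R}$; agent $k$ pays $\pi_k(x,y)$. The utility of agent 1 of type $x$ from outcome $z$ and payment $\pi$ is $x^\top z-\pi$, and that of agent 2 of type $y$ is $y^\top z-\pi$. The allocation rule $T$ is implementable in dominant strategy if there exist payment rules $\pi_1,\pi_2$ such that truthful reporting is a dominant strategy for each agent, i.e. for all $x,x',y,y'\in\mathbb{R}^d$, $$x^\top T(x,y)-\pi_1(x,y)\ge x^\top T(x',y)-\pi_1(x',y),$$ $$y^\top T(x,y)-\pi_2(x,y)\ge y^\top T(x,y')-\pi_2(x,y').$$ Here $\nabla_x$ and $\nabla_y$ denote the gradients with respect to the first and second arguments. The mixed second derivatives of $V_1$ are those obtained by differentiating $\partial V_1/\partial x_i=T^i$ with respect to $y_j$, and those of $V_2$ are obtained by differentiating $\partial V_2/\partial y_j=T^j$ with respect to $x_i$, where $T^i$ is the $i$-th component of $T$. *)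

theory Defs
  imports "HOL-Analysis.Analysis"
begin

(* C^k on the whole space: f is differentiable everywhere and each directional derivative
   p |-> Df(p) v is C^(k-1).  On a finite-dimensional domain this is the usual C^k. *)
primrec cont_diff :: "nat \<Rightarrow> ('a::euclidean_space \<Rightarrow> 'b::real_normed_vector) \<Rightarrow> bool" where
  "cont_diff 0 f \<longleftrightarrow> continuous_on UNIV f"
| "cont_diff (Suc k) f \<longleftrightarrow>
     (\<forall>p. f differentiable (at p)) \<and> (\<forall>v. cont_diff k (\<lambda>p. frechet_derivative f (at p) v))"

definition smooth :: "('a::euclidean_space \<Rightarrow> 'b::real_normed_vector) \<Rightarrow> bool" where
  "smooth f \<longleftrightarrow> (\<forall>k. cont_diff k f)"

definition dominant_strategy_truthful ::
  "((real^'d) \<times> (real^'d) \<Rightarrow> real^'d) \<Rightarrow> ((real^'d) \<times> (real^'d) \<Rightarrow> real) \<Rightarrow>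
   ((real^'d) \<times> (real^'d) \<Rightarrow> real) \<Rightarrow> bool" where
  "dominant_strategy_truthful T \<pi>\<^sub>1 \<pi>\<^sub>2 \<longleftrightarrow>
     (\<forall>x x' y. x \<bullet> T (x, y) - \<pi>\<^sub>1 (x, y) \<ge> x \<bullet> T (x', y) - \<pi>\<^sub>1 (x', y)) \<and>
     (\<forall>x y y'. y \<bullet> T (x, y) - \<pi>\<^sub>2 (x, y) \<ge> y \<bullet> T (x, y') - \<pi>\<^sub>2 (x, y'))"

definition implementable :: "((real^'d) \<times> (real^'d) \<Rightarrow> real^'d) \<Rightarrow> bool" where
  "implementable T \<longleftrightarrow> (\<exists>\<pi>\<^sub>1 \<pi>\<^sub>2. dominant_strategy_truthful T \<pi>\<^sub>1 \<pi>\<^sub>2)"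

(* partial_x i V is the partial derivative of V with respect to x_i.  Since deriv is an
   unspecified value where the derivative does not exist, existence is a separate predicate. *)
definition partial_x ::
  "'d \<Rightarrow> ((real^'d) \<times> (real^'d) \<Rightarrow> real) \<Rightarrow> (real^'d) \<times> (real^'d) \<Rightarrow> real" where
  "partial_x i V = (\<lambda>(x, y). deriv (\<lambda>t. V (x + t *\<^sub>R axis i 1, y)) 0)"

definition partial_y ::
  "'d \<Rightarrow> ((real^'d) \<times> (real^'d) \<Rightarrow> real) \<Rightarrow> (real^'d) \<times> (real^'d) \<Rightarrow> real" where
  "partial_y j V = (\<lambda>(x, y). deriv (\<lambda>t. V (x, y + t *\<^sub>R axis j 1)) 0)"

definition partial_x_exists ::
  "'d \<Rightarrow> ((real^'d) \<times> (real^'d) \<Rightarrow> real) \<Rightarrow> (real^'d) \<times> (real^'d) \<Rightarrow> bool" where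
  "partial_x_exists i V = (\<lambda>(x, y). (\<lambda>t. V (x + t *\<^sub>R axis i 1, y)) differentiable (at 0))"

definition partial_y_exists ::
  "'d \<Rightarrow> ((real^'d) \<times> (real^'d) \<Rightarrow> real) \<Rightarrow> (real^'d) \<times> (real^'d) \<Rightarrow> bool" where
  "partial_y_exists j V = (\<lambda>(x, y). (\<lambda>t. V (x, y + t *\<^sub>R axis j 1)) differentiable (at 0))"

definition positive_semidefinite :: "real^'d^'d \<Rightarrow> bool" where
  "positive_semidefinite A \<longleftrightarrow> transpose A = A \<and> (\<forall>v. 0 \<le> v \<bullet> (A *v v))"

end

theory Submission
  imports Defs
begin

text \<open>
  For fixed \<open>y\<close>, the equilibrium utility \<open>V x = x \<bullet> T (x, y) - \<pi>\<^sub>1 (x, y)\<close> of agent 1 has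
  \<open>T (x, y)\<close> as a subgradient at \<open>x\<close>; since \<open>T\<close> is continuous, the subgradient is a gradient,
  and since subgradients are monotone, the derivative of \<open>T\<close> in \<open>x\<close> is positive semidefinite.
  It is symmetric because it is a Hessian. The same holds for agent 2 in \<open>y\<close>. The mixed second
  derivatives of \<open>V\<^sub>1\<close> are the entries of the derivative of \<open>T\<close> in \<open>y\<close>, so their symmetry and
  positivity come from the incentive constraints of agent 2, and vice versa for \<open>V\<^sub>2\<close>.
\<close>

section \<open>Subgradient maps: differentiability and monotonicity\<close>

text \<open>A selection \<open>f\<close> from the subdifferential of \<open>V\<close>. Convexity of
  \<open>V\<close> is not stated separately: a supporting affine function at every point forces
  it.\<close>

definition subgradient_map :: "('a::real_inner \<Rightarrow> real) \<Rightarrow> ('a \<Rightarrow> 'a) \<Rightarrow> bool" where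
  "subgradient_map V f \<longleftrightarrow> (\<forall>x z. V z \<ge> V x + f x \<bullet> (z - x))"

text \<open>The subgradient inequalities at \<open>x\<close> and at \<open>z\<close> squeeze the
  first-order remainder between 0 and \<open>(f z - f x) \<bullet> (z - x)\<close>. By
  Cauchy-Schwarz it is at most \<open>norm (f z - f x) * norm (z - x)\<close>, and the first factor
  vanishes in the limit by continuity.\<close>

lemma GDERIV_subgradient_map:
  assumes "subgradient_map V f" and "isCont f x"
  shows "GDERIV V x :> f x"
  unfolding gderiv_def
proof (rule has_derivativeI_sandwich[where e = 1 and H = "\<lambda>z. norm (f z - f x)"])
  show "bounded_linear (\<lambda>h. h \<bullet> f x)" by (rule bounded_linear_inner_left)
  show "((\<lambda>z. norm (f z - f x)) \<longlongrightarrow> 0) (at x)"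
    using assms(2) unfolding isCont_def by (simp add: LIM_zero tendsto_norm_zero)
next
  fix z assume "z \<noteq> x"
  have "V z \<ge> V x + f x \<bullet> (z - x)" and "V x \<ge> V z + f z \<bullet> (x - z)"
    using assms(1) unfolding subgradient_map_def by blast+
  then have "\<bar>V z - V x - (z - x) \<bullet> f x\<bar> \<le> (f z - f x) \<bullet> (z - x)"
    by (simp add: inner_diff inner_commute)
  also have "\<dots> \<le> norm (f z - f x) * norm (z - x)" by (rule norm_cauchy_schwarz)
  finally show "norm (V z - V x - (z - x) \<bullet> f x) / norm (z - x) \<le> norm (f z - f x)"
    using \<open>z \<noteq> x\<close> by (simp add: divide_le_eq)
qed simp

text \<open>Adding the subgradient inequalities at two points shows that \<open>f\<close> is
  monotone, so \<open>v \<bullet> f\<close> is nondecreasing along any line in direction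
  \<open>v\<close>. Its slope at \<open>x\<close> is \<open>v \<bullet> A v\<close>.\<close>

lemma has_derivative_psd_of_subgradient_map:
  assumes sub: "subgradient_map V f" and der: "(f has_derivative A) (at x)"
  shows "0 \<le> v \<bullet> A v"
proof -
  interpret A: bounded_linear A using der by (rule has_derivative_bounded_linear)
  have "((\<lambda>t. f (x + t *\<^sub>R v)) has_derivative (\<lambda>t. A (t *\<^sub>R v))) (at (0::real))"
    by (rule has_derivative_compose[of "\<lambda>t. x + t *\<^sub>R v" _ 0 UNIV f A, simplified])
       (auto intro!: derivative_eq_intros der)
  then have "((\<lambda>t. v \<bullet> f (x + t *\<^sub>R v)) has_derivative (\<lambda>t. v \<bullet> A (t *\<^sub>R v))) (at (0::real))"
    by (rule has_derivative_inner_right)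
  then have "((\<lambda>t. v \<bullet> f (x + t *\<^sub>R v)) has_real_derivative (v \<bullet> A v)) (at 0)"
    by (simp add: has_field_derivative_def A.scaleR mult_commute_abs)
  moreover have "mono (\<lambda>t::real. v \<bullet> f (x + t *\<^sub>R v))"
  proof
    fix s t :: real assume "s \<le> t"
    let ?a = "x + s *\<^sub>R v" and ?b = "x + t *\<^sub>R v"
    have "V ?b \<ge> V ?a + f ?a \<bullet> (?b - ?a)" and "V ?a \<ge> V ?b + f ?b \<bullet> (?a - ?b)"
      using sub unfolding subgradient_map_def by blast+
    then have "0 \<le> (f ?b - f ?a) \<bullet> (?b - ?a)"
      by (simp add: inner_diff algebra_simps)
    also have "?b - ?a = (t - s) *\<^sub>R v" by (simp add: scaleR_diff_left)
    finally have "(t - s) * (v \<bullet> f ?a) \<le> (t - s) * (v \<bullet> f ?b)"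
      by (simp add: inner_diff inner_commute)
    then show "v \<bullet> f ?a \<le> v \<bullet> f ?b"
      using \<open>s \<le> t\<close> by (cases "s = t") simp_all
  qed
  ultimately show ?thesis by (intro mono_on_imp_deriv_nonneg[of UNIV]) auto
qed

section \<open>Symmetry of the derivative of a gradient field\<close>

text \<open>The quotient on the left is symmetric in \<open>u\<close> and \<open>w\<close>, which
  makes the limit symmetric too. The mean value theorem in direction \<open>u\<close> replaces the
  second difference by a first difference of \<open>u \<bullet> f\<close>, which is then expanded
  with the derivative of \<open>f\<close> at the single point \<open>x\<close>.\<close>

lemma second_difference_tendsto:
  assumes V: "\<And>x. GDERIV V x :> f x" and der: "(f has_derivative A) (at x)"
  shows "((\<lambda>t. (V (x + t *\<^sub>R u + t *\<^sub>R w) - V (x + t *\<^sub>R u) - V (x + t *\<^sub>R w) + V x) / t\<^sup>2)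
           \<longlongrightarrow> u \<bullet> A w) (at_right 0)"
proof (rule tendstoI)
  interpret A: bounded_linear A using der by (rule has_derivative_bounded_linear)
  fix \<epsilon> :: real assume "\<epsilon> > 0"
  \<comment> \<open>All increments below have norm at most \<open>t * M\<close>. Two remainders of
    size \<open>\<delta> * (t * M)\<close>, multiplied by \<open>t * norm u\<close>, give a total
    error of \<open>t\<^sup>2 * \<delta> * 2 * norm u * M\<close>, and \<delta> is chosen to keep
    this below \<open>t\<^sup>2 * \<epsilon>\<close>. The added 1 keeps the denominator positive
    when \<open>u = 0\<close>.\<close>
  define M where "M = norm u + norm w"
  define \<delta> where "\<delta> = \<epsilon> / (2 * (norm u * M) + 1)"
  have M: "M \<ge> 0" "norm u \<le> M" by (auto simp: M_def)
  then have pos: "2 * (norm u * M) + 1 > 0" by (simp add: add_nonneg_pos)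
  then have "\<delta> > 0" using \<open>\<epsilon> > 0\<close> by (simp add: \<delta>_def)
  then obtain d where "d > 0"
    and d: "\<And>z. norm (z - x) < d \<Longrightarrow> norm (f z - f x - A (z - x)) \<le> \<delta> * norm (z - x)"
    using der unfolding has_derivative_at_alt by blast
  \<comment> \<open>The bound on \<open>t\<close> ensures \<open>t * M < d\<close>; dividing by
    \<open>M + 1\<close> covers \<open>M = 0\<close>.\<close>
  have main: "dist ((V (x + t *\<^sub>R u + t *\<^sub>R w) - V (x + t *\<^sub>R u) - V (x + t *\<^sub>R w) + V x) / t\<^sup>2)
      (u \<bullet> A w) < \<epsilon>" if t: "0 < t" "t < d / (M + 1)" for t
  proof -
    define g where "g = (\<lambda>s. V (x + s *\<^sub>R u + t *\<^sub>R w) - V (x + s *\<^sub>R u))"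
    have along: "((\<lambda>s. V (a + s *\<^sub>R u)) has_real_derivative u \<bullet> f (a + s *\<^sub>R u)) (at s)" for a s
    proof -
      have "((\<lambda>s. a + s *\<^sub>R u) has_derivative (\<lambda>h. h *\<^sub>R u)) (at s)"
        by (auto intro!: derivative_eq_intros)
      moreover have "(V has_derivative (\<lambda>h. h \<bullet> f (a + s *\<^sub>R u))) (at (a + s *\<^sub>R u))"
        using V by (simp add: gderiv_def)
      ultimately have "((\<lambda>s. V (a + s *\<^sub>R u)) has_derivative
          (\<lambda>h. (h *\<^sub>R u) \<bullet> f (a + s *\<^sub>R u))) (at s)"
        by (rule has_derivative_compose)
      then show ?thesis by (simp add: has_field_derivative_def mult_commute_abs)
    qed
    have dg: "(g has_real_derivative u \<bullet> f (x + s *\<^sub>R u + t *\<^sub>R w) - u \<bullet> f (x + s *\<^sub>R u)) (at s)" for s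
      using DERIV_diff[OF along[of "x + t *\<^sub>R w" s] along[of x s]]
      by (simp add: g_def add_ac)
    then obtain s where s: "0 < s" "s < t"
      and gs: "g t - g 0 = (t - 0) * (u \<bullet> f (x + s *\<^sub>R u + t *\<^sub>R w) - u \<bullet> f (x + s *\<^sub>R u))"
      using MVT2[OF \<open>0 < t\<close> dg] by blast
    define r where "r = (\<lambda>z. f z - f x - A (z - x))"
    have small: "norm (r (x + h)) \<le> \<delta> * (t * M)" if "norm h \<le> t * M" for h
    proof -
      have "t * M \<le> t * (M + 1)" using t by simp
      also have "\<dots> < d" using t M by (simp add: pos_less_divide_eq)
      finally have "norm h < d" using that by simp
      then have "norm (r (x + h)) \<le> \<delta> * norm h" using d[of "x + h"] by (simp add: r_def)
      also have "\<dots> \<le> \<delta> * (t * M)" using that \<open>\<delta> > 0\<close> by simp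
      finally show ?thesis .
    qed
    have su: "norm (s *\<^sub>R u) \<le> t * norm u" using s by (simp add: mult_right_mono)
    have 1: "norm (r (x + (s *\<^sub>R u + t *\<^sub>R w))) \<le> \<delta> * (t * M)"
      using norm_triangle_ineq[of "s *\<^sub>R u" "t *\<^sub>R w"] su t
      by (intro small) (simp add: M_def distrib_left)
    have 2: "norm (r (x + s *\<^sub>R u)) \<le> \<delta> * (t * M)"
      using su t by (intro small) (simp add: M_def distrib_left add_increasing2)
    \<comment> \<open>The terms \<open>A (s *\<^sub>R u)\<close> cancel, so the unknown intermediate
      point \<open>s\<close> survives only in the remainders.\<close>
    have "f (x + s *\<^sub>R u + t *\<^sub>R w) - f (x + s *\<^sub>R u)
        = t *\<^sub>R A w + (r (x + (s *\<^sub>R u + t *\<^sub>R w)) - r (x + s *\<^sub>R u))"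
      by (simp add: r_def A.add A.scaleR add.assoc)
    then have "g t - g 0 - t\<^sup>2 * (u \<bullet> A w)
        = t * (u \<bullet> (r (x + (s *\<^sub>R u + t *\<^sub>R w)) - r (x + s *\<^sub>R u)))"
      using gs by (simp add: inner_diff_right[symmetric])
        (simp add: inner_add_right algebra_simps power2_eq_square)
    also have "\<bar>\<dots>\<bar> \<le> t * (norm u * (2 * (\<delta> * (t * M))))"
    proof -
      have "\<bar>u \<bullet> (r (x + (s *\<^sub>R u + t *\<^sub>R w)) - r (x + s *\<^sub>R u))\<bar>
          \<le> norm u * norm (r (x + (s *\<^sub>R u + t *\<^sub>R w)) - r (x + s *\<^sub>R u))"
        by (rule Cauchy_Schwarz_ineq2)
      also have "\<dots> \<le> norm u * (2 * (\<delta> * (t * M)))"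
        using norm_triangle_ineq4[of "r (x + (s *\<^sub>R u + t *\<^sub>R w))" "r (x + s *\<^sub>R u)"] 1 2
        by (intro mult_left_mono) auto
      finally show ?thesis using t by (simp add: abs_mult)
    qed
    also have "\<dots> = t\<^sup>2 * (\<delta> * (2 * (norm u * M)))" by (simp add: power2_eq_square)
    also have "\<dots> < t\<^sup>2 * \<epsilon>"
    proof -
      have "\<delta> * (2 * (norm u * M)) < \<delta> * (2 * (norm u * M) + 1)" using \<open>\<delta> > 0\<close> by simp
      also have "\<dots> = \<epsilon>" using pos by (simp add: \<delta>_def)
      finally show ?thesis using t by simp
    qed
    finally have "\<bar>g t - g 0 - t\<^sup>2 * (u \<bullet> A w)\<bar> / t\<^sup>2 < \<epsilon>" using t by (simp add: divide_less_eq mult.commute)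
    moreover have "(g t - g 0) / t\<^sup>2 - u \<bullet> A w = (g t - g 0 - t\<^sup>2 * (u \<bullet> A w)) / t\<^sup>2"
      using t by (simp add: field_simps)
    ultimately have "\<bar>(g t - g 0) / t\<^sup>2 - u \<bullet> A w\<bar> < \<epsilon>" by simp
    moreover have "g t - g 0
        = V (x + t *\<^sub>R u + t *\<^sub>R w) - V (x + t *\<^sub>R u) - V (x + t *\<^sub>R w) + V x"
      by (simp add: g_def)
    ultimately show ?thesis by (simp add: dist_real_def)
  qed
  have "d / (M + 1) > 0" using \<open>d > 0\<close> M by simp
  then show "\<forall>\<^sub>F t in at_right 0.
      dist ((V (x + t *\<^sub>R u + t *\<^sub>R w) - V (x + t *\<^sub>R u) - V (x + t *\<^sub>R w) + V x) / t\<^sup>2)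
        (u \<bullet> A w) < \<epsilon>"
    unfolding eventually_at_right_field using main by blast
qed

text \<open>Swapping \<open>u\<close> and \<open>w\<close> leaves the second difference unchanged,
  so both values are limits of the same quotient.\<close>

lemma has_derivative_symmetric_of_GDERIV:
  assumes V: "\<And>x. GDERIV V x :> f x" and der: "(f has_derivative A) (at x)"
  shows "u \<bullet> A w = w \<bullet> A u"
proof -
  have "(\<lambda>t. (V (x + t *\<^sub>R w + t *\<^sub>R u) - V (x + t *\<^sub>R w) - V (x + t *\<^sub>R u) + V x) / t\<^sup>2)
      = (\<lambda>t. (V (x + t *\<^sub>R u + t *\<^sub>R w) - V (x + t *\<^sub>R u) - V (x + t *\<^sub>R w) + V x) / t\<^sup>2)"
    by (intro ext) (simp add: algebra_simps)
  then have "((\<lambda>t. (V (x + t *\<^sub>R u + t *\<^sub>R w) - V (x + t *\<^sub>R u) - V (x + t *\<^sub>R w) + V x) / t\<^sup>2)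
      \<longlongrightarrow> w \<bullet> A u) (at_right 0)"
    using second_difference_tendsto[OF V der, of w u] by simp
  with second_difference_tendsto[OF V der, of u w] show ?thesis
    by (rule tendsto_unique[rotated]) simp
qed

text \<open>The matrix is the Jacobian of \<open>f\<close>, hence the Hessian of \<open>V\<close>:
  symmetry comes from \<open>f\<close> being a gradient, nonnegativity from \<open>f\<close> being
  monotone.\<close>

lemma positive_semidefinite_derivative_of_subgradient_map:
  fixes f :: "real^'d \<Rightarrow> real^'d"
  assumes sub: "subgradient_map V f" and diff: "\<And>x. f differentiable at x"
    and der: "(f has_derivative A) (at x)"
  shows "positive_semidefinite (\<chi> i j. A (axis j 1) $ i)"
proof -
  interpret A: bounded_linear A using der by (rule has_derivative_bounded_linear)
  have "(\<chi> i j. A (axis j 1) $ i) = matrix A" by (simp add: matrix_def)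
  moreover have "matrix A *v v = A v" for v
    using A.linear_axioms by (simp add: matrix_works)
  moreover have "GDERIV V z :> f z" for z
    using sub differentiable_imp_continuous_within[OF diff] by (rule GDERIV_subgradient_map)
  then have "A (axis i 1) $ j = A (axis j 1) $ i" for i j
    using has_derivative_symmetric_of_GDERIV[OF _ der, of V "axis j 1" "axis i 1"]
    by (simp add: inner_axis')
  ultimately show ?thesis
    using has_derivative_psd_of_subgradient_map[OF sub der]
    by (simp add: positive_semidefinite_def) (simp add: transpose_def matrix_def vec_eq_iff)
qed

section \<open>Partial derivatives along coordinate axes\<close>

lemma DERIV_component_along_axis:
  fixes f :: "real^'d \<Rightarrow> real^'d"
  assumes "(f has_derivative A) (at y)"
  shows "((\<lambda>t. f (y + t *\<^sub>R axis j 1) $ i) has_real_derivative A (axis j 1) $ i) (at 0)"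
proof -
  interpret A: bounded_linear A using assms by (rule has_derivative_bounded_linear)
  have "((\<lambda>t. y + t *\<^sub>R axis j 1) has_derivative (\<lambda>h. h *\<^sub>R axis j 1)) (at (0::real))"
    by (auto intro!: derivative_eq_intros)
  moreover have "(f has_derivative A) (at (y + 0 *\<^sub>R axis j 1))" using assms by simp
  ultimately have "((\<lambda>t. f (y + t *\<^sub>R axis j 1)) has_derivative (\<lambda>h. A (h *\<^sub>R axis j 1)))
      (at (0::real))"
    by (rule has_derivative_compose)
  then have "((\<lambda>t. f (y + t *\<^sub>R axis j 1) $ i) has_derivative (\<lambda>h. A (h *\<^sub>R axis j 1) $ i))
      (at (0::real))"
    by (rule bounded_linear.has_derivative[OF bounded_linear_vec_nth])
  then show ?thesis by (simp add: has_field_derivative_def A.scaleR mult_commute_abs)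
qed

lemma GDERIV_imp_DERIV_along_axis:
  fixes V :: "real^'d \<Rightarrow> real"
  assumes "GDERIV V x :> g"
  shows "((\<lambda>t. V (x + t *\<^sub>R axis i 1)) has_real_derivative g $ i) (at 0)"
proof -
  have "((\<lambda>t. x + t *\<^sub>R axis i 1) has_derivative (\<lambda>h. h *\<^sub>R axis i 1)) (at (0::real))"
    by (auto intro!: derivative_eq_intros)
  moreover have "(V has_derivative (\<lambda>h. h \<bullet> g)) (at (x + 0 *\<^sub>R axis i 1))"
    using assms by (simp add: gderiv_def)
  ultimately have "((\<lambda>t. V (x + t *\<^sub>R axis i 1)) has_derivative (\<lambda>h. (h *\<^sub>R axis i 1) \<bullet> g))
      (at (0::real))"
    by (rule has_derivative_compose)
  then show ?thesis by (simp add: has_field_derivative_def inner_axis' mult_commute_abs)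
qed

theorem mainTheorem1:
  fixes T :: "(real^'d::finite) \<times> (real^'d) \<Rightarrow> real^'d"
  assumes "smooth T"
    and "implementable T"
  shows "(\<exists>V\<^sub>1 :: (real^'d) \<times> (real^'d) \<Rightarrow> real.
            (\<forall>x y. GDERIV (\<lambda>x'. V\<^sub>1 (x', y)) x :> T (x, y)) \<and>
            (\<forall>p. (\<forall>i j. partial_y_exists j (partial_x i V\<^sub>1) p) \<and>
                 (\<forall>i j. partial_y j (partial_x i V\<^sub>1) p = partial_y i (partial_x j V\<^sub>1) p) \<and>
                 positive_semidefinite (\<chi> i j. partial_y j (partial_x i V\<^sub>1) p))) \<and>
         (\<exists>V\<^sub>2 :: (real^'d) \<times> (real^'d) \<Rightarrow> real.
            (\<forall>x y. GDERIV (\<lambda>y'. V\<^sub>2 (x, y')) y :> T (x, y)) \<and>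
            (\<forall>p. (\<forall>i j. partial_x_exists i (partial_y j V\<^sub>2) p) \<and>
                 (\<forall>i j. partial_x i (partial_y j V\<^sub>2) p = partial_x j (partial_y i V\<^sub>2) p) \<and>
                 positive_semidefinite (\<chi> i j. partial_x i (partial_y j V\<^sub>2) p)))"
proof -
  obtain \<pi>\<^sub>1 \<pi>\<^sub>2 where ic: "dominant_strategy_truthful T \<pi>\<^sub>1 \<pi>\<^sub>2"
    using assms(2) by (auto simp: implementable_def)
  define V\<^sub>1 where "V\<^sub>1 = (\<lambda>p. fst p \<bullet> T p - \<pi>\<^sub>1 p)"
  define V\<^sub>2 where "V\<^sub>2 = (\<lambda>p. snd p \<bullet> T p - \<pi>\<^sub>2 p)"
  \<comment> \<open>Type \<open>z\<close> reporting \<open>x\<close> obtains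
    \<open>V\<^sub>1 (x, y) + T (x, y) \<bullet> (z - x)\<close>, so the truthfulness constraint is
    exactly the subgradient inequality.\<close>
  have sub1: "subgradient_map (\<lambda>x. V\<^sub>1 (x, y)) (\<lambda>x. T (x, y))" for y
    unfolding subgradient_map_def
  proof (intro allI)
    fix x z
    have "z \<bullet> T (z, y) - \<pi>\<^sub>1 (z, y) \<ge> z \<bullet> T (x, y) - \<pi>\<^sub>1 (x, y)"
      using ic unfolding dominant_strategy_truthful_def by blast
    then show "V\<^sub>1 (z, y) \<ge> V\<^sub>1 (x, y) + T (x, y) \<bullet> (z - x)"
      by (simp add: V\<^sub>1_def inner_diff_right inner_commute[of "T _"])
  qed
  have sub2: "subgradient_map (\<lambda>y. V\<^sub>2 (x, y)) (\<lambda>y. T (x, y))" for x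
    unfolding subgradient_map_def
  proof (intro allI)
    fix y z
    have "z \<bullet> T (x, z) - \<pi>\<^sub>2 (x, z) \<ge> z \<bullet> T (x, y) - \<pi>\<^sub>2 (x, y)"
      using ic unfolding dominant_strategy_truthful_def by blast
    then show "V\<^sub>2 (x, z) \<ge> V\<^sub>2 (x, y) + T (x, y) \<bullet> (z - y)"
      by (simp add: V\<^sub>2_def inner_diff_right inner_commute[of "T _"])
  qed
  have "cont_diff (Suc 0) T" using assms(1) unfolding smooth_def by blast
  then have diffT: "T differentiable (at p)" for p
    unfolding cont_diff.simps by blast
  have diff1: "(\<lambda>x. T (x, y)) differentiable (at x)" for x y
    using differentiable_chain_at[of "\<lambda>x. (x, y)" x T] diffT by (simp add: o_def)
  have diff2: "(\<lambda>y. T (x, y)) differentiable (at y)" for x y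
    using differentiable_chain_at[of "\<lambda>y. (x, y)" y T] diffT by (simp add: o_def)
  have G1: "GDERIV (\<lambda>x'. V\<^sub>1 (x', y)) x :> T (x, y)" for x y
    using sub1 differentiable_imp_continuous_within[OF diff1]
    by (rule GDERIV_subgradient_map)
  have G2: "GDERIV (\<lambda>y'. V\<^sub>2 (x, y')) y :> T (x, y)" for x y
    using sub2 differentiable_imp_continuous_within[OF diff2]
    by (rule GDERIV_subgradient_map)
  \<comment> \<open>Differentiating in \<open>x\<close> first matters: \<open>\<pi>\<^sub>1\<close>
    may contain an arbitrary function of \<open>y\<close>, so \<open>V\<^sub>1\<close> itself can be
    irregular in \<open>y\<close>, whereas this partial derivative is a component of
    \<open>T\<close>.\<close>
  have p1: "partial_x i V\<^sub>1 (x, y) = T (x, y) $ i" for i x y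
    unfolding partial_x_def using GDERIV_imp_DERIV_along_axis[OF G1] by (simp add: DERIV_imp_deriv)
  have p2: "partial_y i V\<^sub>2 (x, y) = T (x, y) $ i" for i x y
    unfolding partial_y_def using GDERIV_imp_DERIV_along_axis[OF G2] by (simp add: DERIV_imp_deriv)
  have mixed1: "(\<forall>i j. partial_y_exists j (partial_x i V\<^sub>1) p) \<and>
      (\<forall>i j. partial_y j (partial_x i V\<^sub>1) p = partial_y i (partial_x j V\<^sub>1) p) \<and>
      positive_semidefinite (\<chi> i j. partial_y j (partial_x i V\<^sub>1) p)" for p
  proof -
    obtain x y where p: "p = (x, y)" by (cases p)
    obtain A where A: "((\<lambda>y. T (x, y)) has_derivative A) (at y)"
      using diff2 unfolding differentiable_def by blast
    note D = DERIV_component_along_axis[OF A]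
    have "partial_y j (partial_x i V\<^sub>1) p = A (axis j 1) $ i" for i j
      unfolding p partial_y_def using D by (simp add: p1 DERIV_imp_deriv)
    moreover have "partial_y_exists j (partial_x i V\<^sub>1) p" for i j
      unfolding p partial_y_exists_def
      using D by (auto simp: p1 real_differentiable_def)
    \<comment> \<open>The derivative in \<open>y\<close> is controlled by \<open>sub2\<close>. This
      also yields Fritz John's equation, since \<open>positive_semidefinite\<close> includes
      symmetry.\<close>
    moreover have "positive_semidefinite (\<chi> i j. A (axis j 1) $ i)"
      by (rule positive_semidefinite_derivative_of_subgradient_map[OF sub2 diff2 A])
    ultimately show ?thesis
      by (auto simp: positive_semidefinite_def transpose_def vec_eq_iff)
  qed
  have mixed2: "(\<forall>i j. partial_x_exists i (partial_y j V\<^sub>2) p) \<and>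
      (\<forall>i j. partial_x i (partial_y j V\<^sub>2) p = partial_x j (partial_y i V\<^sub>2) p) \<and>
      positive_semidefinite (\<chi> i j. partial_x i (partial_y j V\<^sub>2) p)" for p
  proof -
    obtain x y where p: "p = (x, y)" by (cases p)
    obtain A where A: "((\<lambda>x. T (x, y)) has_derivative A) (at x)"
      using diff1 unfolding differentiable_def by blast
    note D = DERIV_component_along_axis[OF A]
    have "partial_x i (partial_y j V\<^sub>2) p = A (axis i 1) $ j" for i j
      unfolding p partial_x_def using D by (simp add: p2 DERIV_imp_deriv)
    moreover have "partial_x_exists i (partial_y j V\<^sub>2) p" for i j
      unfolding p partial_x_exists_def
      using D by (auto simp: p2 real_differentiable_def)
    moreover have psd: "positive_semidefinite (\<chi> i j. A (axis j 1) $ i)"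
      by (rule positive_semidefinite_derivative_of_subgradient_map[OF sub1 diff1 A])
    \<comment> \<open>Here the row index is the direction of differentiation and the column index
      the component of \<open>T\<close>, so the matrix is the transposed Jacobian; symmetry
      identifies the two.\<close>
    moreover have "(\<chi> i j. A (axis i 1) $ j) = (\<chi> i j. A (axis j 1) $ i)"
      using psd by (simp add: positive_semidefinite_def transpose_def)
    ultimately show ?thesis
      by (auto simp: vec_eq_iff)
  qed
  show ?thesis using G1 G2 mixed1 mixed2 by blast
qed

end
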